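(* Fix $K\ge2$ and $\beta\ge1$, and assume $n/(\beta K)\ge2$. Fix $(a,b)$ and let $\Theta:=\Theta(n,K,a,b,\beta)$ be the corresponding (nonempty) homogeneous SBM family. Let $M$ be any $\varepsilon$-node-DP mechanism and let $\hat\sigma=M(A)\in[K]^n$ be its output on input adjacency matrix $A$. For each $\theta\in\Theta$ let $\sigma_\theta\in\Sigma_\beta$ be a representative ground-truth labeling corresponding to $\theta$, and let $\mathbb P_\theta,\mathbb E_\theta$ denote probability and expectation under $\theta$ (and the randomness of $M$). Define $$\delta(M):=\sup_{\theta\in\Theta}\mathbb P_\theta\big(r(\sigma_\theta,\hat\sigma)>0\big),\qquad R(M):=\sup_{\theta\in\Theta}\mathbb E_\theta\big[r(\sigma_\theta,\hat\sigma)\big].$$ Then $$\delta(M)\ge\frac{1}{1+e^{2\varepsilon}}\ge\frac12e^{-2\varepsilon},$$ and consequently $$\inf_{M\ \varepsilon\text{-node-DP}}\ \sup_{\theta\in\Theta}\mathbb P_\theta\big(r(\sigma_\theta,M(A))>0\big)\ge\frac{1}{1+e^{2\varepsilon}}.$$ Moreover, $$R(M)\ge\frac{1}{n(1+e^{2\varepsilon})}\ge\frac{1}{2n}e^{-2\varepsilon},$$ and therefore $$\inf_{M\ \varepsilon\text{-node-DP}}\ \sup_{\theta\in\Theta}\mathbb E_\theta\big[r(\sigma_\theta,M(A))\big]\ge\frac{1}{n(1+e^{2\varepsilon})}.$$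
   Context: Graphs on $[n]=\{1,\dots,n\}$ are identified with symmetric zero-diagonal matrices $A\in\{0,1\}^{n\times n}$. $A\sim_v A'$ (node-adjacent) if $A,A'$ differ only in the incident edges of a single vertex $v$. A randomized mechanism $M$ on graphs is $\varepsilon$-node-DP ($\varepsilon>0$) if $\mathbb P(M(A)\in S)\le e^{\varepsilon}\,\mathbb P(M(A')\in S)$ for all measurable $S$ and all $A\sim_v A'$. $\Sigma_\beta$ is the set of $\sigma:[n]\to[K]$ with $\frac{n}{\beta K}\le|\{i:\sigma(i)=k\}|\le\frac{\beta n}{K}$ for all $k\in[K]$. For $\sigma_0\in\Sigma_\beta$ and $n\ge a>b\ge0$, $\mathrm{SBM}(\sigma_0)$ is the law of the random graph whose entries $A_{ij}$, $i<j$, are independent with $\mathbb P(A_{ij}=1)=a/n$ if $\sigma_0(i)=\sigma_0(j)$ and $b/n$ otherwise. $\Theta(n,K,a,b,\beta)$ is the family of these models, $\sigma_0\in\Sigma_\beta$; each parameter $\theta$ corresponds to a labeling $\sigma_\theta\in\Sigma_\beta$ determined up to permutation of the community labels $[K]$, and an arbitrary representative is fixed. $r(\sigma,\hat\sigma):=\min_{\pi\in S_K}\frac1n\sum_{i=1}^n\mathbf 1\{\sigma(i)\ne\pi(\hat\sigma(i))\}$, with $S_K$ the permutations of $[K]$. *)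

theory Defs
  imports "HOL-Probability.Probability"
begin

text \<open>
  A graph on \<open>[n] = {1..n}\<close> is a symmetric 0/1 matrix with zero diagonal, encoded as a function
  on pairs of naturals that is 0 outside \<open>[n] \<times> [n]\<close>, so that equality of functions is equality
  of matrices.
\<close>

type_synonym adj = "nat \<Rightarrow> nat \<Rightarrow> nat"

type_synonym labeling = "nat \<Rightarrow> nat"

definition graphs :: "nat \<Rightarrow> adj set" where
  "graphs n = {A. (\<forall>i j. A i j \<in> {0, 1}) \<and> (\<forall>i j. A i j = A j i) \<and> (\<forall>i. A i i = 0) \<and>
                  (\<forall>i j. i \<notin> {1..n} \<or> j \<notin> {1..n} \<longrightarrow> A i j = 0)}"

definition node_adjacent :: "nat \<Rightarrow> nat \<Rightarrow> adj \<Rightarrow> adj \<Rightarrow> bool" where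
  "node_adjacent n v A A' \<longleftrightarrow> A \<in> graphs n \<and> A' \<in> graphs n \<and> v \<in> {1..n} \<and>
     (\<forall>i\<in>{1..n}. \<forall>j\<in>{1..n}. i \<noteq> v \<and> j \<noteq> v \<longrightarrow> A i j = A' i j)"

definition labelings :: "nat \<Rightarrow> nat \<Rightarrow> labeling set" where
  "labelings n K = {1..n} \<rightarrow>\<^sub>E {1..K}"

text \<open>
  The output space \<open>[K]\<^sup>n\<close> is finite, so an output distribution is a probability mass function
  and every set of outputs is measurable. The behaviour of a mechanism on functions that are not
  graphs on \<open>[n]\<close> is irrelevant and left unconstrained.
\<close>

definition node_DP :: "nat \<Rightarrow> real \<Rightarrow> (adj \<Rightarrow> 'o pmf) \<Rightarrow> bool" where
  "node_DP n \<epsilon> M \<longleftrightarrow> (\<forall>v A A'. node_adjacent n v A A' \<longrightarrow>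
     (\<forall>S. measure_pmf.prob (M A) S \<le> exp \<epsilon> * measure_pmf.prob (M A') S))"

definition DP_mechanisms :: "nat \<Rightarrow> nat \<Rightarrow> real \<Rightarrow> (adj \<Rightarrow> labeling pmf) set" where
  "DP_mechanisms n K \<epsilon> =
     {M. (\<forall>A\<in>graphs n. set_pmf (M A) \<subseteq> labelings n K) \<and> node_DP n \<epsilon> M}"

definition balanced_labelings :: "nat \<Rightarrow> nat \<Rightarrow> real \<Rightarrow> labeling set" where
  "balanced_labelings n K \<beta> = {\<sigma> \<in> labelings n K. \<forall>k\<in>{1..K}.
     real n / (\<beta> * real K) \<le> real (card {i \<in> {1..n}. \<sigma> i = k}) \<and>
     real (card {i \<in> {1..n}. \<sigma> i = k}) \<le> \<beta> * real n / real K}"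

text \<open>
  The independent entries above the diagonal are drawn first and then reflected. \<^const>\<open>Pi_pmf\<close>
  yields \<^term>\<open>False\<close> outside its index set, which gives the zero diagonal and the zeros outside
  \<open>[n] \<times> [n]\<close>.
\<close>

definition SBM :: "nat \<Rightarrow> real \<Rightarrow> real \<Rightarrow> labeling \<Rightarrow> adj pmf" where
  "SBM n a b \<sigma> =
     map_pmf (\<lambda>E i j. of_bool (E (min i j, max i j)))
       (Pi_pmf {(i, j). 1 \<le> i \<and> i < j \<and> j \<le> n} False
          (\<lambda>(i, j). bernoulli_pmf (if \<sigma> i = \<sigma> j then a / real n else b / real n)))"

definition SBM_family :: "nat \<Rightarrow> nat \<Rightarrow> real \<Rightarrow> real \<Rightarrow> real \<Rightarrow> adj pmf set" where
  "SBM_family n K a b \<beta> = SBM n a b ` balanced_labelings n K \<beta>"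

definition mismatch :: "nat \<Rightarrow> nat \<Rightarrow> labeling \<Rightarrow> labeling \<Rightarrow> real" where
  "mismatch n K \<sigma> \<sigma>' =
     (MIN \<pi>\<in>{\<pi>. \<pi> permutes {1..K}}. 1 / real n * (\<Sum>i = 1..n. of_bool (\<sigma> i \<noteq> \<pi> (\<sigma>' i))))"

text \<open>
  The law of the output \<open>M(A)\<close> for \<open>A\<close> drawn from \<open>\<theta>\<close> is \<^term>\<open>bind_pmf \<theta> M\<close>. The argument
  \<open>rep\<close> below is the choice \<open>\<theta> \<mapsto> \<sigma>\<^sub>\<theta>\<close> of representatives.
\<close>

definition worst_error_prob ::
  "nat \<Rightarrow> nat \<Rightarrow> adj pmf set \<Rightarrow> (adj pmf \<Rightarrow> labeling) \<Rightarrow> (adj \<Rightarrow> labeling pmf) \<Rightarrow> real" where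
  "worst_error_prob n K \<Theta> rep M =
     (SUP \<theta>\<in>\<Theta>. measure_pmf.prob (bind_pmf \<theta> M) {\<sigma>'. mismatch n K (rep \<theta>) \<sigma>' > 0})"

definition worst_risk ::
  "nat \<Rightarrow> nat \<Rightarrow> adj pmf set \<Rightarrow> (adj pmf \<Rightarrow> labeling) \<Rightarrow> (adj \<Rightarrow> labeling pmf) \<Rightarrow> real" where
  "worst_risk n K \<Theta> rep M =
     (SUP \<theta>\<in>\<Theta>. measure_pmf.expectation (bind_pmf \<theta> M) (\<lambda>\<sigma>'. mismatch n K (rep \<theta>) \<sigma>'))"

end

theory Submission imports Defs begin

text \<open>
  Two labels in different communities are interchanged. The resulting model can be coupled with the
  original one so that the two graphs differ only at two vertices, hence the output laws agree up to
  the factor \<open>exp (2 * \<epsilon>)\<close>. As every community has at least two members, the two models are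
  different, so no output recovers both labelings, and a two-point argument gives the bound on the
  error probability. The bound on the risk follows because a nonzero mismatch is at least \<open>1 / n\<close>.
\<close>

section \<open>Mixtures of probability mass functions\<close>

lemma prob_bind_pmf:
  "measure_pmf.prob (bind_pmf p f) S = measure_pmf.expectation p (\<lambda>x. measure_pmf.prob (f x) S)"
  by (subst measure_pmf_bind, subst measure_pmf.measure_bind[where N = "count_space UNIV"])
    (auto simp: measure_pmf_in_subprob_algebra)

lemma prob_bind_pmf_mono:
  assumes "\<And>x. x \<in> set_pmf p \<Longrightarrow> measure_pmf.prob (f x) S \<le> c * measure_pmf.prob (g x) S"
  shows "measure_pmf.prob (bind_pmf p f) S \<le> c * measure_pmf.prob (bind_pmf p g) S"
proof -
  have int: "integrable (measure_pmf p) (\<lambda>x. measure_pmf.prob (h x) S)" for h :: "'a \<Rightarrow> 'b pmf"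
    by (rule measure_pmf.integrable_const_bound[where B = 1]) auto
  have "measure_pmf.expectation p (\<lambda>x. measure_pmf.prob (f x) S)
      \<le> measure_pmf.expectation p (\<lambda>x. c * measure_pmf.prob (g x) S)"
    using assms int by (intro integral_mono_AE) (auto simp: AE_measure_pmf_iff)
  then show ?thesis
    by (simp add: prob_bind_pmf)
qed

text \<open>This is the independent coupling: a bound valid for every pair of samples survives
  averaging over \<open>p\<close> and \<open>q\<close> separately, so the two mixing laws need no
  relation.\<close>

lemma prob_bind_pmf_mono_indep:
  assumes "\<And>x y. x \<in> set_pmf p \<Longrightarrow> y \<in> set_pmf q \<Longrightarrow>
      measure_pmf.prob (f x) S \<le> c * measure_pmf.prob (g y) S"
  shows "measure_pmf.prob (bind_pmf p f) S \<le> c * measure_pmf.prob (bind_pmf q g) S"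
proof -
  have "measure_pmf.prob (bind_pmf p f) S
      \<le> c * measure_pmf.prob (bind_pmf p (\<lambda>_. bind_pmf q g)) S"
  proof (rule prob_bind_pmf_mono)
    fix x assume x: "x \<in> set_pmf p"
    \<comment> \<open>Mixing the constant law \<open>f x\<close> over \<open>q\<close> does not
      change it, so both sides become mixtures over the same \<open>q\<close>.\<close>
    have "measure_pmf.prob (bind_pmf q (\<lambda>_. f x)) S \<le> c * measure_pmf.prob (bind_pmf q g) S"
      by (rule prob_bind_pmf_mono) (rule assms[OF x])
    then show "measure_pmf.prob (f x) S \<le> c * measure_pmf.prob (bind_pmf q g) S"
      by simp
  qed
  then show ?thesis
    by simp
qed

section \<open>Node privacy at two vertices\<close>

lemma node_DP_two_nodes:
  assumes DP: "node_DP n \<epsilon> M" and A: "A \<in> graphs n" and A': "A' \<in> graphs n"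
    and u: "u \<in> {1..n}" and v: "v \<in> {1..n}"
    and agree: "\<And>i j. i \<notin> {u, v} \<Longrightarrow> j \<notin> {u, v} \<Longrightarrow> A i j = A' i j"
  shows "measure_pmf.prob (M A) S \<le> exp (2 * \<epsilon>) * measure_pmf.prob (M A') S"
proof -
  \<comment> \<open>The hybrid graph takes all entries at \<open>u\<close> from \<open>A'\<close>.
    It differs from \<open>A\<close> only at \<open>u\<close>, and by \<open>agree\<close> from
    \<open>A'\<close> only at \<open>v\<close>; each step costs one factor
    \<open>exp \<epsilon>\<close>.\<close>
  define B where "B = (\<lambda>i j. if i = u \<or> j = u then A' i j else A i j)"
  have B: "B \<in> graphs n"
    using A A' by (auto simp: graphs_def B_def)
  have "node_adjacent n u A B" "node_adjacent n v B A'"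
    using A A' B u v agree by (auto simp: node_adjacent_def B_def)
  then have 1: "measure_pmf.prob (M A) S \<le> exp \<epsilon> * measure_pmf.prob (M B) S"
    and 2: "measure_pmf.prob (M B) S \<le> exp \<epsilon> * measure_pmf.prob (M A') S"
    using DP by (auto simp: node_DP_def)
  note 1
  also have "exp \<epsilon> * measure_pmf.prob (M B) S \<le> exp \<epsilon> * (exp \<epsilon> * measure_pmf.prob (M A') S)"
    using 2 by simp
  also have "\<dots> = exp (2 * \<epsilon>) * measure_pmf.prob (M A') S"
    by (simp flip: exp_add)
  finally show ?thesis .
qed

text \<open>Ignoring the input is perfectly private. This shows that the infima over mechanisms
  range over a nonempty set.\<close>

lemma const_DP_mechanism:
  assumes "\<sigma> \<in> labelings n K" and "\<epsilon> \<ge> 0"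
  shows "(\<lambda>_. return_pmf \<sigma>) \<in> DP_mechanisms n K \<epsilon>"
proof -
  have "1 * x \<le> exp \<epsilon> * x" if "x \<ge> 0" for x :: real
    using assms(2) that by (intro mult_right_mono) auto
  then show ?thesis
    using assms(1) by (auto simp: DP_mechanisms_def node_DP_def)
qed

section \<open>The block model\<close>

definition graph_of :: "(nat \<times> nat \<Rightarrow> bool) \<Rightarrow> adj" where
  "graph_of E = (\<lambda>i j. of_bool (E (min i j, max i j)))"

definition edge_slots :: "nat \<Rightarrow> (nat \<times> nat) set" where
  "edge_slots n = {(i, j). 1 \<le> i \<and> i < j \<and> j \<le> n}"

definition edge_law :: "nat \<Rightarrow> real \<Rightarrow> real \<Rightarrow> labeling \<Rightarrow> nat \<times> nat \<Rightarrow> bool pmf" where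
  "edge_law n a b \<sigma> = (\<lambda>(i, j). bernoulli_pmf (if \<sigma> i = \<sigma> j then a / real n else b / real n))"

lemma SBM_eq: "SBM n a b \<sigma> = map_pmf graph_of (Pi_pmf (edge_slots n) False (edge_law n a b \<sigma>))"
  by (simp add: SBM_def graph_of_def[abs_def] edge_slots_def edge_law_def)

lemma finite_edge_slots [simp]: "finite (edge_slots n)"
  by (rule finite_subset[of _ "{1..n} \<times> {1..n}"]) (auto simp: edge_slots_def)

lemma graph_of_in_graphs:
  assumes "\<And>e. e \<notin> edge_slots n \<Longrightarrow> \<not> E e"
  shows "graph_of E \<in> graphs n"
proof -
  have "graph_of E i j = graph_of E j i" for i j
    by (simp add: graph_of_def min.commute max.commute)
  moreover have "graph_of E i j \<in> {0, 1}" for i j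
    by (simp add: graph_of_def)
  moreover have "graph_of E i j = 0" if "i = j \<or> i \<notin> {1..n} \<or> j \<notin> {1..n}" for i j
  proof -
    have "(min i j, max i j) \<notin> edge_slots n"
      using that by (auto simp: edge_slots_def)
    with assms show ?thesis
      by (simp add: graph_of_def)
  qed
  ultimately show ?thesis
    unfolding graphs_def by blast
qed

text \<open>The edge probabilities see a labeling only through the partition it induces.\<close>

lemma SBM_cong:
  assumes "\<And>i j. i \<in> {1..n} \<Longrightarrow> j \<in> {1..n} \<Longrightarrow> \<sigma> i = \<sigma> j \<longleftrightarrow> \<tau> i = \<tau> j"
  shows "SBM n a b \<sigma> = SBM n a b \<tau>"
proof -
  have "Pi_pmf (edge_slots n) False (edge_law n a b \<sigma>)
      = Pi_pmf (edge_slots n) False (edge_law n a b \<tau>)"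
    using assms by (intro Pi_pmf_cong) (auto simp: edge_slots_def edge_law_def)
  then show ?thesis
    by (simp add: SBM_eq)
qed

lemma SBM_edge:
  assumes "i \<in> {1..n}" "j \<in> {1..n}" "i \<noteq> j"
  shows "map_pmf (\<lambda>A. A i j = 1) (SBM n a b \<sigma>)
    = bernoulli_pmf (if \<sigma> i = \<sigma> j then a / real n else b / real n)"
proof -
  have slot: "(min i j, max i j) \<in> edge_slots n"
    using assms by (auto simp: edge_slots_def min_def max_def)
  have "map_pmf (\<lambda>A. A i j = 1) (SBM n a b \<sigma>)
      = map_pmf (\<lambda>E. E (min i j, max i j)) (Pi_pmf (edge_slots n) False (edge_law n a b \<sigma>))"
    by (simp add: SBM_eq map_pmf_comp graph_of_def)
  also have "\<dots> = edge_law n a b \<sigma> (min i j, max i j)"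
    using slot by (simp add: Pi_pmf_component)
  also have "\<dots> = bernoulli_pmf (if \<sigma> i = \<sigma> j then a / real n else b / real n)"
    by (auto simp: edge_law_def min_def max_def)
  finally show ?thesis .
qed

text \<open>The edge between \<open>i\<close> and \<open>j\<close> has probability
  \<open>a / n\<close> in one model and \<open>b / n\<close> in the other, so already this marginal
  separates them.\<close>

lemma SBM_neq:
  assumes ij: "i \<in> {1..n}" "j \<in> {1..n}" "i \<noteq> j" and "\<sigma> i = \<sigma> j" and "\<tau> i \<noteq> \<tau> j"
    and ab: "real n \<ge> a" "a > b" "b \<ge> 0"
  shows "SBM n a b \<sigma> \<noteq> SBM n a b \<tau>"
proof
  assume "SBM n a b \<sigma> = SBM n a b \<tau>"
  then have "bernoulli_pmf (a / real n) = bernoulli_pmf (b / real n)"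
    using SBM_edge[OF ij, of a b \<sigma>] SBM_edge[OF ij, of a b \<tau>] assms(4,5) by simp
  then have "pmf (bernoulli_pmf (a / real n)) True = pmf (bernoulli_pmf (b / real n)) True"
    by simp
  moreover have "n > 0"
    using ij by auto
  \<comment> \<open>The bounds on \<open>a\<close> and \<open>b\<close> put both parameters in the
    unit interval, where \<open>bernoulli_pmf\<close> does not clip them.\<close>
  ultimately show False
    using ab by simp
qed

text \<open>Entries avoiding \<open>u\<close> and \<open>v\<close> have the same law under both
  labelings and are shared; the remaining ones are drawn independently for the two models. Every
  resulting pair of graphs differs only at \<open>u\<close> and \<open>v\<close>, so privacy at two
  vertices applies pointwise.\<close>

lemma prob_SBM_bind_le:
  assumes DP: "node_DP n \<epsilon> M" and u: "u \<in> {1..n}" and v: "v \<in> {1..n}"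
    and agree: "\<And>i. i \<notin> {u, v} \<Longrightarrow> \<sigma> i = \<tau> i"
  shows "measure_pmf.prob (bind_pmf (SBM n a b \<sigma>) M) S
    \<le> exp (2 * \<epsilon>) * measure_pmf.prob (bind_pmf (SBM n a b \<tau>) M) S"
proof -
  define J where "J = {e \<in> edge_slots n. fst e \<notin> {u, v} \<and> snd e \<notin> {u, v}}"
  define L where "L = edge_slots n - J"
  define join where "join = (\<lambda>f g e. if e \<in> J then f e else (g e :: bool))"
  have fin: "finite J" "finite L" and disj: "J \<inter> L = {}" and un: "edge_slots n = J \<union> L"
    by (auto simp: J_def L_def)
  have split: "bind_pmf (SBM n a b \<rho>) M
      = bind_pmf (Pi_pmf J False (edge_law n a b \<rho>)) (\<lambda>f.
          bind_pmf (Pi_pmf L False (edge_law n a b \<rho>)) (\<lambda>g. M (graph_of (join f g))))" for \<rho>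
    unfolding SBM_eq un Pi_pmf_union[OF fin disj] join_def
    by (simp add: pair_pmf_def map_pmf_def bind_assoc_pmf bind_return_pmf)
  have J_eq: "Pi_pmf J False (edge_law n a b \<sigma>) = Pi_pmf J False (edge_law n a b \<tau>)"
    using agree fin by (intro Pi_pmf_cong) (auto simp: J_def edge_law_def)
  have graph: "graph_of (join f g) \<in> graphs n"
    if "f \<in> set_pmf (Pi_pmf J False (edge_law n a b \<tau>))"
      and "g \<in> set_pmf (Pi_pmf L False (edge_law n a b \<rho>))" for f g \<rho>
  proof (rule graph_of_in_graphs)
    fix e assume "e \<notin> edge_slots n"
    then have "e \<notin> J" "e \<notin> L"
      by (auto simp: un)
    then show "\<not> join f g e"
      using that set_Pi_pmf_subset[OF fin(2), of False "edge_law n a b \<rho>"]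
      by (cases e) (auto simp: join_def)
  qed
  have same: "graph_of (join f g) i j = graph_of (join f h) i j"
    if "g \<in> set_pmf (Pi_pmf L False (edge_law n a b \<sigma>))"
      and "h \<in> set_pmf (Pi_pmf L False (edge_law n a b \<tau>))"
      and ij: "i \<notin> {u, v}" "j \<notin> {u, v}" for f g h i j
  proof -
    \<comment> \<open>Such an entry is either read from the shared \<open>f\<close> or lies outside
      \<open>L\<close>, where \<open>g\<close> and \<open>h\<close> both take the default
      \<open>False\<close>.\<close>
    have "(min i j, max i j) \<notin> L"
      using ij by (auto simp: L_def J_def min_def max_def)
    then show ?thesis
      using that set_Pi_pmf_subset[OF fin(2), of False "edge_law n a b \<sigma>"]
        set_Pi_pmf_subset[OF fin(2), of False "edge_law n a b \<tau>"]
      by (auto simp: join_def graph_of_def)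
  qed
  show ?thesis
    unfolding split J_eq
    \<comment> \<open>The outer mixture over \<open>J\<close> is common to both sides, while the
      inner ones over \<open>L\<close> are coupled independently.\<close>
    by (intro prob_bind_pmf_mono prob_bind_pmf_mono_indep node_DP_two_nodes[OF DP _ _ u v])
      (auto intro: graph same simp del: insert_iff)
qed

section \<open>The mismatch\<close>

text \<open>The minimum is over a finite nonempty set of permutations. The properties of
  \<open>mismatch\<close> below are read off from a minimizer.\<close>

lemma mismatch_attained:
  obtains \<pi> where "\<pi> permutes {1..K}"
    and "mismatch n K \<sigma> \<sigma>' = 1 / real n * real (card {i \<in> {1..n}. \<sigma> i \<noteq> \<pi> (\<sigma>' i)})"
proof -
  have "finite {\<pi>. \<pi> permutes {1..K}}"
    by (intro finite_permutations) simp
  moreover have "{\<pi>. \<pi> permutes {1..K}} \<noteq> {}"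
    using permutes_id by blast
  ultimately have "mismatch n K \<sigma> \<sigma>'
      \<in> (\<lambda>\<pi>. 1 / real n * (\<Sum>i = 1..n. of_bool (\<sigma> i \<noteq> \<pi> (\<sigma>' i)))) ` {\<pi>. \<pi> permutes {1..K}}"
    unfolding mismatch_def
    by (intro Min_in finite_imageI) (simp_all only: image_is_empty not_False_eq_True)
  then obtain \<pi> where "\<pi> permutes {1..K}"
    and "mismatch n K \<sigma> \<sigma>' = 1 / real n * (\<Sum>i = 1..n. of_bool (\<sigma> i \<noteq> \<pi> (\<sigma>' i)))"
    by auto
  moreover have "{1..n} \<inter> {i. \<sigma> i \<noteq> \<pi> (\<sigma>' i)} = {i \<in> {1..n}. \<sigma> i \<noteq> \<pi> (\<sigma>' i)}"
    by blast
  then have "(\<Sum>i = 1..n. of_bool (\<sigma> i \<noteq> \<pi> (\<sigma>' i)))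
      = real (card {i \<in> {1..n}. \<sigma> i \<noteq> \<pi> (\<sigma>' i)})"
    by (subst sum_of_bool_eq) simp_all
  ultimately show ?thesis
    using that by simp
qed

lemma mismatch_nonneg: "mismatch n K \<sigma> \<sigma>' \<ge> 0"
  proof (rule mismatch_attained[of K n \<sigma> \<sigma>'])
  fix \<pi>
  assume "mismatch n K \<sigma> \<sigma>' = 1 / real n * real (card {i \<in> {1..n}. \<sigma> i \<noteq> \<pi> (\<sigma>' i)})"
  then show ?thesis
    by simp
qed

lemma mismatch_le_1: "mismatch n K \<sigma> \<sigma>' \<le> 1"
proof (rule mismatch_attained[of K n \<sigma> \<sigma>'])
  fix \<pi>
  assume eq: "mismatch n K \<sigma> \<sigma>' = 1 / real n * real (card {i \<in> {1..n}. \<sigma> i \<noteq> \<pi> (\<sigma>' i)})"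
  have "card {i \<in> {1..n}. \<sigma> i \<noteq> \<pi> (\<sigma>' i)} \<le> card {1..n}"
    by (intro card_mono) auto
  then show ?thesis
    unfolding eq by (cases "n = 0") (auto simp: field_simps)
qed

text \<open>The mismatch is an integer multiple of \<open>1 / n\<close>.\<close>

lemma mismatch_pos_imp_ge:
  assumes "mismatch n K \<sigma> \<sigma>' > 0"
  shows "mismatch n K \<sigma> \<sigma>' \<ge> 1 / real n"
proof (rule mismatch_attained[of K n \<sigma> \<sigma>'])
  fix \<pi>
  assume eq: "mismatch n K \<sigma> \<sigma>' = 1 / real n * real (card {i \<in> {1..n}. \<sigma> i \<noteq> \<pi> (\<sigma>' i)})"
  with assms have "card {i \<in> {1..n}. \<sigma> i \<noteq> \<pi> (\<sigma>' i)} \<noteq> 0"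
    by (metis less_irrefl mult_zero_right of_nat_0)
  then have "1 \<le> real (card {i \<in> {1..n}. \<sigma> i \<noteq> \<pi> (\<sigma>' i)})"
    by linarith
  from mult_left_mono[OF this, of "1 / real n"] show ?thesis
    unfolding eq by simp
qed

text \<open>For an optimal \<pi> no vertex is mislabeled, so \<sigma> is \<sigma>' followed by the
  injective map \<pi>.\<close>

lemma mismatch_zero_imp_same_blocks:
  assumes "mismatch n K \<sigma> \<sigma>' \<le> 0" and ij: "i \<in> {1..n}" "j \<in> {1..n}"
  shows "\<sigma> i = \<sigma> j \<longleftrightarrow> \<sigma>' i = \<sigma>' j"
proof (rule mismatch_attained[of K n \<sigma> \<sigma>'])
  fix \<pi>
  assume perm: "\<pi> permutes {1..K}"
    and eq: "mismatch n K \<sigma> \<sigma>' = 1 / real n * real (card {i \<in> {1..n}. \<sigma> i \<noteq> \<pi> (\<sigma>' i)})"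
  have "n > 0"
    using ij by auto
  with assms(1)[unfolded eq] have "card {i \<in> {1..n}. \<sigma> i \<noteq> \<pi> (\<sigma>' i)} = 0"
    by (simp add: divide_le_0_iff)
  then have "{i \<in> {1..n}. \<sigma> i \<noteq> \<pi> (\<sigma>' i)} = {}"
    by (subst (asm) card_0_eq) auto
  then have "\<sigma> i = \<pi> (\<sigma>' i)" "\<sigma> j = \<pi> (\<sigma>' j)"
    using ij by blast+
  then show ?thesis
    by (simp only: inj_eq[OF permutes_inj[OF perm]])
qed

text \<open>Both labelings induce the partition of \<rho>. Read contrapositively, one output cannot
  be correct for two different models.\<close>

lemma SBM_eq_of_common_recovery:
  assumes "mismatch n K \<sigma> \<rho> \<le> 0" and "mismatch n K \<tau> \<rho> \<le> 0"
  shows "SBM n a b \<sigma> = SBM n a b \<tau>"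
  using mismatch_zero_imp_same_blocks[OF assms(1)] mismatch_zero_imp_same_blocks[OF assms(2)]
  by (intro SBM_cong) simp

section \<open>Interchanging two labels\<close>

lemma swap_in_balanced_labelings:
  assumes \<sigma>: "\<sigma> \<in> balanced_labelings n K \<beta>" and u: "u \<in> {1..n}" and v: "v \<in> {1..n}"
  shows "\<sigma> \<circ> Transposition.transpose u v \<in> balanced_labelings n K \<beta>"
proof -
  define t where "t = Transposition.transpose u v"
  have perm: "t permutes {1..n}"
    unfolding t_def using u v by (rule permutes_swap_id)
  have in_iff: "t i \<in> {1..n} \<longleftrightarrow> i \<in> {1..n}" for i
    using perm by (rule permutes_in_image)
  have invol: "t (t i) = i" for i
    by (simp add: t_def)
  \<comment> \<open>The involution \<open>t\<close> maps each of the two sets onto the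
    other.\<close>
  have "card {i \<in> {1..n}. (\<sigma> \<circ> t) i = k} = card {i \<in> {1..n}. \<sigma> i = k}" for k
    by (rule bij_betw_same_card[OF bij_betw_byWitness[where f = t and f' = t]])
      (use in_iff invol in \<open>auto simp del: atLeastAtMost_iff\<close>)
  moreover have "\<sigma> \<circ> t \<in> labelings n K"
    unfolding labelings_def
  proof (rule PiE_I)
    fix i assume "i \<in> {1..n}"
    then have "t i \<in> {1..n}"
      by (simp only: in_iff)
    then show "(\<sigma> \<circ> t) i \<in> {1..K}"
      using \<sigma> unfolding balanced_labelings_def labelings_def comp_def by blast
  next
    fix i assume i: "i \<notin> {1..n}"
    then have "t i = i"
      by (rule permutes_not_in[OF perm])
    moreover have "\<sigma> \<in> {1..n} \<rightarrow>\<^sub>E {1..K}"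
      using \<sigma> by (simp add: balanced_labelings_def labelings_def)
    ultimately show "(\<sigma> \<circ> t) i = undefined"
      using PiE_arb[OF _ i] by simp
  qed
  ultimately show ?thesis
    using \<sigma> unfolding balanced_labelings_def t_def by simp
qed

text \<open>Here \<open>u\<close> and \<open>v\<close> are the vertices to be interchanged, and
  \<open>w\<close> is a second member of the community of \<open>u\<close> that stays behind and
  witnesses that the partition changes.\<close>

lemma balanced_labeling_vertices:
  assumes \<sigma>: "\<sigma> \<in> balanced_labelings n K \<beta>" and "K \<ge> 2" and two: "real n / (\<beta> * real K) \<ge> 2"
  obtains u v w where "u \<in> {1..n}" "v \<in> {1..n}" "w \<in> {1..n}" "u \<noteq> w" "\<sigma> u = \<sigma> w" "\<sigma> u \<noteq> \<sigma> v"
proof -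
  have ge2: "card {i \<in> {1..n}. \<sigma> i = k} \<ge> 2" if "k \<in> {1..K}" for k
  proof -
    have "real n / (\<beta> * real K) \<le> real (card {i \<in> {1..n}. \<sigma> i = k})"
      using \<sigma> that by (simp add: balanced_labelings_def)
    with two show ?thesis
      by linarith
  qed
  \<comment> \<open>Communities 1 and 2 exist because \<open>K\<close> is at least 2;
    \<open>u\<close> and \<open>w\<close> come from the first, \<open>v\<close> from the
    second.\<close>
  have 1: "2 \<le> card {i \<in> {1..n}. \<sigma> i = 1}" and 2: "2 \<le> card {i \<in> {1..n}. \<sigma> i = 2}"
    by (rule ge2, use \<open>K \<ge> 2\<close> in simp)+
  obtain T where T: "T \<subseteq> {i \<in> {1..n}. \<sigma> i = 1}" "card T = 2"
    using obtain_subset_with_card_n[OF 1] by metis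
  obtain u w where "T = {u, w}" "u \<noteq> w"
    using T(2) by (meson card_2_iff)
  with T(1) have uw: "u \<in> {1..n}" "w \<in> {1..n}" "\<sigma> u = 1" "\<sigma> w = 1"
    by blast+
  have "{i \<in> {1..n}. \<sigma> i = 2} \<noteq> {}"
    using 2 by (metis card.empty not_numeral_le_zero)
  then obtain v where v: "v \<in> {1..n}" "\<sigma> v = 2"
    by blast
  show ?thesis
    by (rule that[OF uw(1) v(1) uw(2) \<open>u \<noteq> w\<close>]) (simp_all add: uw v)
qed

section \<open>The lower bounds\<close>

text \<open>This is Markov's inequality at level \<open>1 / n\<close>, the smallest possible nonzero
  mismatch.\<close>

lemma expectation_mismatch_ge:
  "measure_pmf.expectation p (mismatch n K \<sigma>)
    \<ge> 1 / real n * measure_pmf.prob p {\<sigma>'. mismatch n K \<sigma> \<sigma>' > 0}"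
proof -
  have "measure_pmf.expectation p (\<lambda>\<sigma>'. 1 / real n * indicator {\<sigma>'. mismatch n K \<sigma> \<sigma>' > 0} \<sigma>')
      \<le> measure_pmf.expectation p (mismatch n K \<sigma>)"
  proof (rule integral_mono)
    show "integrable (measure_pmf p) (mismatch n K \<sigma>)"
      using mismatch_nonneg mismatch_le_1
      by (intro measure_pmf.integrable_const_bound[where B = 1]) auto
  qed (use mismatch_nonneg mismatch_pos_imp_ge in
      \<open>auto simp: indicator_def intro!: measure_pmf.integrable_const_bound[where B = "1 / real n"]\<close>)
  then show ?thesis
    by simp
qed

lemma expectation_mismatch_le_1: "measure_pmf.expectation p (mismatch n K \<sigma>) \<le> 1"
  using mismatch_nonneg mismatch_le_1
  by (intro measure_pmf.integral_le_const measure_pmf.integrable_const_bound[where B = 1]) auto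

text \<open>Think of \<open>E\<close> and \<open>F\<close> as the failure events under
  \<open>p\<close> and \<open>q\<close>. An output that succeeds for \<open>p\<close> fails for
  \<open>q\<close>, whence \<open>1 - \<delta> \<le> p(-E) \<le> c * q(-E) \<le> c * q(F) \<le> c *
  \<delta>\<close>.\<close>

lemma two_point_bound:
  fixes p q :: "'a pmf" and c \<delta> :: real
  assumes c: "c \<ge> 0" and le: "measure_pmf.prob p (- E) \<le> c * measure_pmf.prob q (- E)"
    and cover: "E \<union> F = UNIV"
    and p: "measure_pmf.prob p E \<le> \<delta>" and q: "measure_pmf.prob q F \<le> \<delta>"
  shows "\<delta> \<ge> 1 / (1 + c)"
proof -
  have "measure_pmf.prob q (- E) \<le> measure_pmf.prob q F"
    using cover by (intro measure_pmf.finite_measure_mono) auto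
  with q have "c * measure_pmf.prob q (- E) \<le> c * \<delta>"
    using c by (intro mult_left_mono) auto
  moreover have "measure_pmf.prob p (- E) = 1 - measure_pmf.prob p E"
    using measure_pmf.prob_compl[of E p] by (simp add: Compl_eq_Diff_UNIV)
  ultimately have "1 \<le> \<delta> * (1 + c)"
    using le p by (simp add: algebra_simps)
  then show ?thesis
    using c by (simp add: field_simps)
qed

lemma worst_error_prob_ge:
  assumes "K \<ge> 2" and "real n / (\<beta> * real K) \<ge> 2" and ab: "real n \<ge> a" "a > b" "b \<ge> 0"
    and \<Theta>: "\<Theta> = SBM_family n K a b \<beta>" and "\<Theta> \<noteq> {}"
    and rep: "\<And>\<theta>. \<theta> \<in> \<Theta> \<Longrightarrow> rep \<theta> \<in> balanced_labelings n K \<beta> \<and> SBM n a b (rep \<theta>) = \<theta>"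
    and M: "node_DP n \<epsilon> M"
  shows "worst_error_prob n K \<Theta> rep M \<ge> 1 / (1 + exp (2 * \<epsilon>))"
proof -
  define err where "err \<theta> = {\<sigma>'. mismatch n K (rep \<theta>) \<sigma>' > 0}" for \<theta>
  obtain \<theta> where \<theta>: "\<theta> \<in> \<Theta>"
    using \<open>\<Theta> \<noteq> {}\<close> by blast
  define \<sigma> where "\<sigma> = rep \<theta>"
  have \<sigma>: "\<sigma> \<in> balanced_labelings n K \<beta>" and \<sigma>_\<theta>: "SBM n a b \<sigma> = \<theta>"
    using rep[OF \<theta>] by (auto simp: \<sigma>_def)
  obtain u v w where uvw: "u \<in> {1..n}" "v \<in> {1..n}" "w \<in> {1..n}"
    "u \<noteq> w" "\<sigma> u = \<sigma> w" "\<sigma> u \<noteq> \<sigma> v"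
    using balanced_labeling_vertices[OF \<sigma> assms(1,2)] by metis
  define \<tau> where "\<tau> = \<sigma> \<circ> Transposition.transpose u v"
  define \<eta> where "\<eta> = SBM n a b \<tau>"
  have \<eta>: "\<eta> \<in> \<Theta>"
    using swap_in_balanced_labelings[OF \<sigma> uvw(1,2)]
    by (auto simp: \<Theta> SBM_family_def \<eta>_def \<tau>_def)
  have "w \<noteq> v"
    using uvw by auto
  \<comment> \<open>The swap gives \<open>u\<close> the label of \<open>v\<close> and leaves
    \<open>w\<close> fixed, so \<open>u\<close> and \<open>w\<close> are separated.\<close>
  then have "\<tau> u \<noteq> \<tau> w"
    using uvw by (auto simp: \<tau>_def Transposition.transpose_def)
  then have neq: "\<theta> \<noteq> \<eta>"
    using SBM_neq[OF uvw(1,3,4,5) _ ab] by (auto simp: \<eta>_def simp flip: \<sigma>_\<theta>)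
  \<comment> \<open>The representative of \<eta> may differ from \<tau>, so the argument compares
    the models and not the labelings.\<close>
  have cover: "err \<theta> \<union> err \<eta> = UNIV"
  proof (rule ccontr)
    assume "err \<theta> \<union> err \<eta> \<noteq> UNIV"
    then obtain \<rho> where "\<rho> \<notin> err \<theta>" "\<rho> \<notin> err \<eta>"
      by blast
    then have "mismatch n K (rep \<theta>) \<rho> \<le> 0" "mismatch n K (rep \<eta>) \<rho> \<le> 0"
      by (simp_all add: err_def)
    then have "SBM n a b (rep \<theta>) = SBM n a b (rep \<eta>)"
      by (rule SBM_eq_of_common_recovery)
    with rep[OF \<theta>] rep[OF \<eta>] neq show False
      by simp
  qed
  have le: "measure_pmf.prob (bind_pmf \<theta> M) S \<le> exp (2 * \<epsilon>) * measure_pmf.prob (bind_pmf \<eta> M) S"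
    for S
    using prob_SBM_bind_le[OF M uvw(1,2), of \<sigma> \<tau> a b S]
    by (auto simp: \<eta>_def \<sigma>_\<theta> \<tau>_def Transposition.transpose_def)
  have sup: "measure_pmf.prob (bind_pmf \<theta>' M) (err \<theta>') \<le> worst_error_prob n K \<Theta> rep M"
    if "\<theta>' \<in> \<Theta>" for \<theta>'
    unfolding worst_error_prob_def err_def using that
    \<comment> \<open>Suprema of reals require a bounded family; probabilities are bounded by
      1.\<close>
    by (intro cSUP_upper bdd_aboveI2[where M = 1]) auto
  show ?thesis
    by (rule two_point_bound[OF _ le cover sup[OF \<theta>] sup[OF \<eta>]]) simp
qed

text \<open>The Markov bound holds for each \<theta>. Multiplying by \<open>n\<close> first leaves a
  plain supremum on the left, to be bounded term by term.\<close>

lemma worst_risk_ge: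
  assumes "n > 0" and "\<Theta> \<noteq> {}"
  shows "worst_risk n K \<Theta> rep M \<ge> 1 / real n * worst_error_prob n K \<Theta> rep M"
proof -
  have "worst_error_prob n K \<Theta> rep M \<le> real n * worst_risk n K \<Theta> rep M"
    unfolding worst_error_prob_def
  proof (rule cSUP_least[OF assms(2)])
    fix \<theta> assume "\<theta> \<in> \<Theta>"
    then have "measure_pmf.expectation (bind_pmf \<theta> M) (mismatch n K (rep \<theta>))
        \<le> worst_risk n K \<Theta> rep M"
      unfolding worst_risk_def using expectation_mismatch_le_1
      by (intro cSUP_upper bdd_aboveI2[where M = 1])
    with expectation_mismatch_ge[of n "bind_pmf \<theta> M" K "rep \<theta>"]
    have "1 / real n * measure_pmf.prob (bind_pmf \<theta> M) {\<sigma>'. mismatch n K (rep \<theta>) \<sigma>' > 0}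
        \<le> worst_risk n K \<Theta> rep M"
      by linarith
    then show "measure_pmf.prob (bind_pmf \<theta> M) {\<sigma>'. mismatch n K (rep \<theta>) \<sigma>' > 0}
        \<le> real n * worst_risk n K \<Theta> rep M"
      using assms(1) by (simp add: field_simps)
  qed
  then show ?thesis
    using assms(1) by (simp add: field_simps)
qed

lemma inverse_one_plus_exp_ge:
  fixes x :: real
  assumes "x \<ge> 0"
  shows "1 / (1 + exp x) \<ge> 1 / 2 * exp (- x)"
proof -
  have "1 / (1 + exp x) \<ge> 1 / (2 * exp x)"
    using assms by (intro divide_left_mono) (auto simp: add_pos_pos)
  then show ?thesis
    by (simp add: exp_minus field_simps)
qed

theorem theorem4p1:
  fixes n K :: nat and a b \<beta> \<epsilon> :: real
    and \<Theta> :: "adj pmf set" and rep :: "adj pmf \<Rightarrow> labeling"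
  assumes "K \<ge> 2" and "\<beta> \<ge> 1" and "real n / (\<beta> * real K) \<ge> 2"
    and "real n \<ge> a" and "a > b" and "b \<ge> 0" and "\<epsilon> > 0"
    and "\<Theta> = SBM_family n K a b \<beta>" and "\<Theta> \<noteq> {}"
    and "\<And>\<theta>. \<theta> \<in> \<Theta> \<Longrightarrow> rep \<theta> \<in> balanced_labelings n K \<beta> \<and> SBM n a b (rep \<theta>) = \<theta>"
  shows "(\<forall>M \<in> DP_mechanisms n K \<epsilon>.
            worst_error_prob n K \<Theta> rep M \<ge> 1 / (1 + exp (2 * \<epsilon>)) \<and>
            1 / (1 + exp (2 * \<epsilon>)) \<ge> 1 / 2 * exp (- 2 * \<epsilon>)) \<and>
         (INF M \<in> DP_mechanisms n K \<epsilon>. worst_error_prob n K \<Theta> rep M)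
            \<ge> 1 / (1 + exp (2 * \<epsilon>)) \<and>
         (\<forall>M \<in> DP_mechanisms n K \<epsilon>.
            worst_risk n K \<Theta> rep M \<ge> 1 / (real n * (1 + exp (2 * \<epsilon>))) \<and>
            1 / (real n * (1 + exp (2 * \<epsilon>))) \<ge> 1 / (2 * real n) * exp (- 2 * \<epsilon>)) \<and>
         (INF M \<in> DP_mechanisms n K \<epsilon>. worst_risk n K \<Theta> rep M)
            \<ge> 1 / (real n * (1 + exp (2 * \<epsilon>)))"
proof -
  let ?D = "DP_mechanisms n K \<epsilon>"
  let ?c = "1 + exp (2 * \<epsilon>)"
  \<comment> \<open>For \<open>n = 0\<close> the ratio in the size assumption would be 0.\<close>
  have n: "n > 0"
    using assms(3) by (intro gr0I) simp
  obtain \<theta> where "\<theta> \<in> \<Theta>"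
    using assms(9) by blast
  then have "rep \<theta> \<in> labelings n K"
    using assms(10) by (auto simp: balanced_labelings_def)
  \<comment> \<open>Any labeling would serve as constant output; a representative is at hand since
    the family is nonempty.\<close>
  then have "(\<lambda>_. return_pmf (rep \<theta>)) \<in> ?D"
    by (rule const_DP_mechanism) (use assms(7) in simp)
  then have nonempty: "?D \<noteq> {}"
    by blast
  have error: "worst_error_prob n K \<Theta> rep M \<ge> 1 / ?c" if "M \<in> ?D" for M
    using worst_error_prob_ge[OF assms(1,3-6,8-10)] that by (auto simp: DP_mechanisms_def)
  have risk: "worst_risk n K \<Theta> rep M \<ge> 1 / (real n * ?c)" if "M \<in> ?D" for M
  proof -
    have "1 / (real n * ?c) = 1 / real n * (1 / ?c)"
      by simp
    also have "\<dots> \<le> 1 / real n * worst_error_prob n K \<Theta> rep M"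
      using error[OF that] by (intro mult_left_mono) auto
    also have "\<dots> \<le> worst_risk n K \<Theta> rep M"
      by (rule worst_risk_ge[OF n assms(9)])
    finally show ?thesis .
  qed
  have num: "1 / ?c \<ge> 1 / 2 * exp (- 2 * \<epsilon>)"
    using inverse_one_plus_exp_ge[of "2 * \<epsilon>"] assms(7) by simp
  have "1 / real n * (1 / ?c) \<ge> 1 / real n * (1 / 2 * exp (- 2 * \<epsilon>))"
    using num by (intro mult_left_mono) auto
  then have num': "1 / (real n * ?c) \<ge> 1 / (2 * real n) * exp (- 2 * \<epsilon>)"
    by (simp add: mult.commute)
  show ?thesis
    by (intro conjI ballI error risk num num' cINF_greatest[OF nonempty])
qed

end
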